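(* Let $k \ge 3$ be an integer, let $z$ be a real number with $z < 2\sqrt{k-1}$, set $L = k/\sqrt{k-1}$, and let $m$ be the smallest positive integer such that \[ \frac{z}{\sqrt{k-1}} < \alpha_m := 2\cos\!\left(\frac{\pi}{m+1}\right). \] Define \[ F_m(x) = \sum_{j=0}^m V_{2j}(x), \qquad \widehat{F}_m(x) = \frac{F_m(x)}{x-\alpha_m}. \] For any real $s$ with $0 < s < \alpha_m - \frac{z}{\sqrt{k-1}}$, write the polynomial $x \mapsto \widehat{F}_m(x+s)$ as $\sum_j c_j(s) V_j(x)$. Then $c_j(s) \ge 0$ for all $j$, $c_0(s) > 0$, and \[ v(k,z) \le \frac{\widehat{F}_m(L+s)}{c_0(s)}. \]
   Context: $U_j$ denotes the $j$-th Chebyshev polynomial of the second kind, $U_j(\cos\theta) = \sin((j+1)\theta)/\sin\theta$, and $V_j(x) = U_j(x/2)$; thus $V_0 = 1$, $V_1 = x$, $V_{j+1} = xV_j - V_{j-1}$, and $\alpha_m$ is the largest root of $V_m$. For a finite connected $k$-regular graph $X$, $\mu_1(X)$ denotes the second largest eigenvalue (with multiplicity) of its adjacency matrix. $v(k,z)$ denotes the maximum number of vertices of a finite connected $k$-regular graph $X$ with $\mu_1(X) \le z$ (possibly $\infty$). *)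

theory Defs
  imports
    Complex_Main
    "HOL-Library.Extended_Real"
    "HOL-Library.Multiset"
    "HOL-Computational_Algebra.Polynomial"
    "Graph_Theory.Graph_Theory"
    "Jordan_Normal_Form.Char_Poly"
begin

hide_const (open) Module.smult

section \<open>Chebyshev polynomials of the second kind\<close>

fun cheb_U :: "nat \<Rightarrow> real poly" where
  "cheb_U 0 = 1"
| "cheb_U (Suc 0) = [:0, 2:]"
| "cheb_U (Suc (Suc j)) = [:0, 2:] * cheb_U (Suc j) - cheb_U j"

lemma cheb_U_cos_mult_sin: "poly (cheb_U j) (cos t) * sin t = sin (real (j + 1) * t)"
proof (induction j rule: cheb_U.induct)
  case 2
  then show ?case using sin_double[of t] by simp
next
  case (3 j)
  have "sin (real (j + 3) * t) + sin (real (j + 1) * t) = 2 * cos t * sin (real (j + 2) * t)"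
    using sin_add[of "real (j + 2) * t" t] sin_diff[of "real (j + 2) * t" t]
    by (simp add: algebra_simps)
  with 3 show ?case by (simp add: algebra_simps)
qed auto

lemma cheb_U_cos:
  assumes "sin t \<noteq> 0"
  shows "poly (cheb_U j) (cos t) = sin (real (j + 1) * t) / sin t"
  using cheb_U_cos_mult_sin[of j t] assms by (simp add: field_simps)

definition cheb_V :: "nat \<Rightarrow> real poly" where
  "cheb_V j = pcompose (cheb_U j) [:0, 1/2:]"

lemma cheb_V_0: "cheb_V 0 = 1"
  and cheb_V_1: "cheb_V (Suc 0) = [:0, 1:]"
  and cheb_V_Suc_Suc: "cheb_V (Suc (Suc j)) = [:0, 1:] * cheb_V (Suc j) - cheb_V j"
  by (simp_all add: cheb_V_def pcompose_1 pcompose_pCons pcompose_diff pcompose_mult pcompose_smult)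

lemma poly_cheb_V: "poly (cheb_V j) x = poly (cheb_U j) (x / 2)"
  by (simp add: cheb_V_def poly_pcompose)

definition alpha :: "nat \<Rightarrow> real" where
  "alpha m = 2 * cos (pi / real (m + 1))"

lemma cheb_V_gt_2:
  assumes "x \<ge> 2"
  shows "poly (cheb_V j) x > 0 \<and> poly (cheb_V (Suc j)) x \<ge> poly (cheb_V j) x"
proof (induction j)
  case 0
  then show ?case using assms by (simp add: cheb_V_0 cheb_V_1)
next
  case (Suc j)
  have "2 * poly (cheb_V (Suc j)) x \<le> x * poly (cheb_V (Suc j)) x"
    using assms Suc by (intro mult_right_mono) auto
  moreover have "poly (cheb_V (Suc (Suc j))) x = x * poly (cheb_V (Suc j)) x - poly (cheb_V j) x"
    by (simp add: cheb_V_Suc_Suc)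
  ultimately have "poly (cheb_V (Suc j)) x \<le> poly (cheb_V (Suc (Suc j))) x"
    using Suc by linarith
  with Suc show ?case by auto
qed

lemma alpha_largest_root_V:
  assumes "m > 0"
  shows "poly (cheb_V m) (alpha m) = 0" and "\<And>x. poly (cheb_V m) x = 0 \<Longrightarrow> x \<le> alpha m"
proof -
  define t where "t = pi / real (m + 1)"
  have t: "0 < t" "t < pi" "real (m + 1) * t = pi"
    using assms by (auto simp: t_def field_simps)
  have "sin t > 0" using t by (intro sin_gt_zero) auto
  with cheb_U_cos_mult_sin[of m t] t(3) show "poly (cheb_V m) (alpha m) = 0"
    by (simp add: poly_cheb_V alpha_def t_def)
  fix x assume x: "poly (cheb_V m) x = 0"
  show "x \<le> alpha m"
  proof (rule ccontr)
    assume "\<not> x \<le> alpha m"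
    hence gt: "cos t < x / 2" by (simp add: alpha_def t_def)
    have "x < 2" using cheb_V_gt_2[of x m] x by fastforce
    have ge: "-1 \<le> x / 2" using gt cos_ge_minus_one[of t] by linarith
    define u where "u = arccos (x / 2)"
    have abs: "\<bar>x / 2\<bar> \<le> 1" using ge \<open>x < 2\<close> by (simp add: abs_le_iff)
    have "cos u = x / 2" using abs unfolding u_def by (intro cos_arccos_abs)
    moreover have "0 < u"
      using arccos_lt_bounded[of "x / 2"] gt \<open>x < 2\<close> cos_ge_minus_one[of t] by (simp add: u_def)
    moreover have "u < t"
    proof -
      have "u < arccos (cos t)" unfolding u_def
        using gt abs by (subst arccos_less_mono) auto
      thus ?thesis using arccos_cos[of t] t by simp
    qed
    ultimately have u: "cos u = x / 2" "0 < u" "u < t" by auto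
    have "real (m + 1) * u < pi"
      using u t(3) by (metis mult_strict_left_mono of_nat_0_less_iff zero_less_Suc Suc_eq_plus1)
    hence "sin (real (m + 1) * u) > 0" using u by (intro sin_gt_zero) auto
    with cheb_U_cos_mult_sin[of m u] x u(1) show False by (simp add: poly_cheb_V)
  qed
qed

section \<open>The polynomials $F_m$ and $F_m(x) / (x - \alpha_m)$\<close>

definition F_poly :: "nat \<Rightarrow> real poly" where
  "F_poly m = (\<Sum>j=0..m. cheb_V (2 * j))"

definition F_hat :: "nat \<Rightarrow> real poly" where
  "F_hat m = F_poly m div [:- alpha m, 1:]"

lemma poly_F_cos: "poly (F_poly m) (2 * cos t) * (sin t)\<^sup>2 = (sin (real (m + 1) * t))\<^sup>2"
proof (induction m)
  case 0
  then show ?case by (simp add: F_poly_def cheb_V_0)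
next
  case (Suc m)
  define a where "a = real (m + 1) * t"
  have c: "(cos y)\<^sup>2 = 1 - (sin y)\<^sup>2" for y :: real by (simp add: cos_squared_eq)
  have e: "real (2 * Suc m + 1) * t = (a + t) + a" "real (Suc m + 1) * t = a + t"
    by (simp_all add: a_def algebra_simps)
  have "poly (cheb_V (2 * Suc m)) (2 * cos t) * (sin t)\<^sup>2 = sin ((a + t) + a) * sin t"
    using cheb_U_cos_mult_sin[of "2 * Suc m" t] unfolding e
    by (simp add: poly_cheb_V power2_eq_square del: cheb_U.simps)
  also have "\<dots> = sin ((a + t) + a) * sin ((a + t) - a)" by simp
  also have "\<dots> = (sin (a + t))\<^sup>2 * (cos a)\<^sup>2 - (cos (a + t))\<^sup>2 * (sin a)\<^sup>2"
    unfolding sin_add[of "a + t" a] sin_diff[of "a + t" a]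
    by (simp add: algebra_simps power2_eq_square)
  also have "\<dots> = (sin (a + t))\<^sup>2 - (sin a)\<^sup>2"
    unfolding c by (simp add: algebra_simps)
  finally have "poly (cheb_V (2 * Suc m)) (2 * cos t) * (sin t)\<^sup>2 = (sin (a + t))\<^sup>2 - (sin a)\<^sup>2" .
  moreover have "F_poly (Suc m) = F_poly m + cheb_V (2 * Suc m)" by (simp add: F_poly_def)
  moreover have "poly (F_poly m) (2 * cos t) * (sin t)\<^sup>2 = (sin a)\<^sup>2" using Suc unfolding a_def .
  ultimately show ?case unfolding e by (simp only: poly_add distrib_right)
qed

lemma F_eq_mult_F_hat:
  assumes "m > 0"
  shows "F_poly m = [:- alpha m, 1:] * F_hat m"
proof -
  define t where "t = pi / real (m + 1)"
  have t: "0 < t" "t < pi" "real (m + 1) * t = pi"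
    using assms by (auto simp: t_def field_simps)
  have "sin t > 0" using t by (intro sin_gt_zero) auto
  with poly_F_cos[of m t] t(3) have "poly (F_poly m) (alpha m) = 0"
    by (simp add: alpha_def t_def)
  hence "[:- alpha m, 1:] dvd F_poly m" by (simp only: poly_eq_0_iff_dvd)
  thus ?thesis unfolding F_hat_def by (simp only: dvd_mult_div_cancel)
qed

lemma degree_cheb_V: "degree (cheb_V j) = j" and lead_coeff_cheb_V: "lead_coeff (cheb_V j) = 1"
proof -
  have "degree (cheb_V j) = j \<and> coeff (cheb_V j) j = 1 \<and> degree (cheb_V (Suc j)) = Suc j \<and> coeff (cheb_V (Suc j)) (Suc j) = 1"
  proof (induction j)
    case 0
    then show ?case by (simp add: cheb_V_0 cheb_V_1)
  next
    case (Suc j)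
    have e: "cheb_V (Suc (Suc j)) = pCons 0 (cheb_V (Suc j)) - cheb_V j" by (simp add: cheb_V_Suc_Suc)
    have nz: "cheb_V (Suc j) \<noteq> 0" using Suc by auto
    have "degree (cheb_V (Suc (Suc j))) = degree (pCons 0 (cheb_V (Suc j)))"
      unfolding e using Suc nz
      by (metis add_uminus_conv_diff degree_add_eq_left degree_minus degree_pCons_eq lessI less_Suc_eq)
    moreover have "coeff (cheb_V j) (Suc (Suc j)) = 0" using Suc by (intro coeff_eq_0) auto
    ultimately show ?case using Suc nz by (simp add: e)
  qed
  thus "degree (cheb_V j) = j" "lead_coeff (cheb_V j) = 1" by auto
qed

text \<open>The coefficients of a polynomial in the basis $cheb_V_0, cheb_V_1, \ldots$ of the space of real
  polynomials.\<close>

definition cheb_V_coeffs :: "real poly \<Rightarrow> nat \<Rightarrow> real" where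
  "cheb_V_coeffs p = (THE c. finite {j. c j \<noteq> 0} \<and> p = (\<Sum>j | c j \<noteq> 0. smult (c j) (cheb_V j)))"

lemma cheb_V_span: "(\<And>i. i \<ge> n \<Longrightarrow> coeff p i = 0) \<Longrightarrow>
  \<exists>c. (\<forall>j\<ge>n. c j = 0) \<and> p = (\<Sum>j<n. smult (c j) (cheb_V j))"
proof (induction n arbitrary: p)
  case 0
  then show ?case by (intro exI[of _ "\<lambda>_. 0"]) (simp add: poly_eq_iff)
next
  case (Suc n)
  define q where "q = p - smult (coeff p n) (cheb_V n)"
  have "coeff q i = 0" if "i \<ge> n" for i
  proof (cases "i = n")
    case True
    then show ?thesis using lead_coeff_cheb_V[of n] by (simp add: q_def degree_cheb_V)
  next
    case False
    then show ?thesis using Suc.prems[of i] that by (simp add: q_def coeff_eq_0 degree_cheb_V)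
  qed
  from Suc.IH[OF this] obtain c where c: "\<forall>j\<ge>n. c j = 0" "q = (\<Sum>j<n. smult (c j) (cheb_V j))"
    by blast
  show ?case
  proof (intro exI[of _ "c(n := coeff p n)"] conjI)
    have "(\<Sum>j<n. smult ((c(n := coeff p n)) j) (cheb_V j)) = q"
      unfolding c(2) by (intro sum.cong) auto
    then show "p = (\<Sum>j<Suc n. smult ((c(n := coeff p n)) j) (cheb_V j))"
      by (simp add: q_def)
  qed (use c in auto)
qed

lemma cheb_V_indep: "(\<Sum>j<n. smult (c j) (cheb_V j)) = 0 \<Longrightarrow> j < n \<Longrightarrow> c j = 0"
proof (induction n)
  case (Suc n)
  have "coeff (\<Sum>j<n. smult (c j) (cheb_V j)) n = 0"
    by (simp add: coeff_sum coeff_eq_0 degree_cheb_V)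
  hence "coeff (\<Sum>j<Suc n. smult (c j) (cheb_V j)) n = c n"
    using lead_coeff_cheb_V[of n] by (simp add: degree_cheb_V)
  hence "c n = 0" unfolding Suc.prems(1) by simp
  with Suc show ?case by (auto simp: less_Suc_eq)
qed auto

lemma ex1_V_coeffs:
  "\<exists>!c. finite {j. c j \<noteq> 0} \<and> p = (\<Sum>j | c j \<noteq> 0. smult (c j) (cheb_V j))"
proof -
  have eq: "(\<Sum>j | c j \<noteq> 0. smult (c j) (cheb_V j)) = (\<Sum>j<n. smult (c j) (cheb_V j))"
    if "\<forall>j\<ge>n. c j = 0" for c n
  proof (rule sum.mono_neutral_left)
    show "{j. c j \<noteq> 0} \<subseteq> {..<n}" using that linorder_not_le by blast
  qed auto
  have fin: "finite {j. c j \<noteq> 0}" if "\<forall>j\<ge>n. c j = 0" for c :: "nat \<Rightarrow> real" and n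
  proof (rule finite_subset)
    show "{j. c j \<noteq> 0} \<subseteq> {..<n}" using that linorder_not_le by blast
  qed simp
  obtain c where c: "\<forall>j\<ge>Suc (degree p). c j = 0" "p = (\<Sum>j<Suc (degree p). smult (c j) (cheb_V j))"
    using cheb_V_span[of "Suc (degree p)" p] by (auto simp: coeff_eq_0)
  show ?thesis
  proof (rule ex1I[of _ c])
    show "finite {j. c j \<noteq> 0} \<and> p = (\<Sum>j | c j \<noteq> 0. smult (c j) (cheb_V j))"
      using c fin[OF c(1)] eq[OF c(1)] by simp
    fix d assume d: "finite {j. d j \<noteq> 0} \<and> p = (\<Sum>j | d j \<noteq> 0. smult (d j) (cheb_V j))"
    then obtain N where N: "\<forall>j\<in>{j. d j \<noteq> 0}. j < N" using finite_nat_set_iff_bounded by blast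
    define n where "n = max N (Suc (degree p))"
    have z: "\<forall>j\<ge>n. c j = 0" "\<forall>j\<ge>n. d j = 0" using c(1) N by (auto simp: n_def)
    have "p = (\<Sum>j<n. smult (c j) (cheb_V j))" "p = (\<Sum>j<n. smult (d j) (cheb_V j))"
      using c d eq[OF c(1)] eq[OF z(1)] eq[OF z(2)] by auto
    hence "(\<Sum>j<n. smult (c j - d j) (cheb_V j)) = 0"
      by (simp add: smult_diff_left sum_subtractf)
    hence "c j - d j = 0" for j using cheb_V_indep[of "\<lambda>j. c j - d j" n j] z by (cases "j < n") auto
    thus "d = c" by (auto simp: fun_eq_iff)
  qed
qed

section \<open>Regular graphs and their second largest eigenvalue\<close>

text \<open>Graphs are finite, undirected and simple. Their vertices are taken to be natural numbers,
  which is no restriction up to isomorphism.\<close>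

definition regular_graph :: "nat \<Rightarrow> nat pair_pre_digraph \<Rightarrow> bool" where
  "regular_graph k X \<longleftrightarrow>
     pair_graph X \<and> (\<forall>u \<in> pverts X. out_degree (with_proj X) u = k)"

definition adjacency_matrix :: "nat pair_pre_digraph \<Rightarrow> real mat" where
  "adjacency_matrix X =
     (let vs = sorted_list_of_set (pverts X); n = length vs
      in mat n n (\<lambda>(i, j). if (vs ! i, vs ! j) \<in> parcs X then 1 else 0))"

text \<open>The adjacency matrix is real symmetric, so all its eigenvalues are real. They are listed with
  multiplicity in descending order; the entry with index 0 is the largest eigenvalue.\<close>

definition eigenvalue_list :: "nat pair_pre_digraph \<Rightarrow> real list" where
  "eigenvalue_list X =
     rev (sorted_list_of_multiset (proots (char_poly (adjacency_matrix X))))"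

definition mu1 :: "nat pair_pre_digraph \<Rightarrow> real" where
  "mu1 X = eigenvalue_list X ! 1"

text \<open>The supremum in \<^typ>\<open>enat\<close> of a nonempty set is its maximum if the set is bounded,
  and \<open>\<infinity>\<close> otherwise; it is \<open>0\<close> if no graph qualifies.\<close>

definition v_max :: "nat \<Rightarrow> real \<Rightarrow> enat" where
  "v_max k z = Sup {enat (card (pverts X)) | X.
     regular_graph k X \<and> Digraph_Component.connected (with_proj X) \<and> mu1 X \<le> z}"

end

theory Submission
  imports Defs "Jordan_Normal_Form.Schur_Decomposition"
begin

hide_const (open) Module.smult

text \<open>This is a linear programming bound. Let \<open>A\<close> be the adjacency matrix of a \<open>k\<close>-regular graph
  with \<open>n\<close> vertices and let \<open>q = sqrt (k - 1)\<close>. The matrices \<open>q\<^sup>j V\<^sub>j (A / q)\<close> count non-backtracking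
  walks of the lengths \<open>j, j - 2, \<dots>\<close>, so their traces are nonnegative. Hence a polynomial
  \<open>p = (\<Sum>j. c\<^sub>j V\<^sub>j)\<close> with \<open>c\<^sub>j \<ge> 0\<close> satisfies \<open>n c\<^sub>0 \<le> (\<Sum>\<mu>. p (\<mu> / q))\<close> over the eigenvalues \<open>\<mu>\<close>
  of \<open>A\<close>. If moreover \<open>p \<le> 0\<close> below \<open>z / q\<close>, only the eigenvalue \<open>k\<close> contributes positively, and
  \<open>n c\<^sub>0 \<le> p (k / q)\<close>.

  For the polynomial \<open>p (x) = F_hat m (x + s)\<close> the sign condition holds because \<open>F_poly m = V\<^sub>m\<^sup>2\<close>. By
  Christoffel-Darboux, \<open>V\<^sub>m / (x - \<alpha>\<^sub>m) = (\<Sum>j<m. V\<^sub>j (\<alpha>\<^sub>m) V\<^sub>j)\<close> has positive coefficients, and the cone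
  of polynomials with nonnegative coefficients in the basis \<open>V\<^sub>j\<close> is closed under products and under
  shifts \<open>x \<mapsto> x + s\<close> with \<open>s \<ge> 0\<close>.\<close>

section \<open>Polynomials with nonnegative Chebyshev coefficients\<close>

lemma cheb_V_coeffs_eqI:
  assumes "\<And>j. j \<ge> n \<Longrightarrow> c j = 0" and "p = (\<Sum>j<n. smult (c j) (cheb_V j))"
  shows "cheb_V_coeffs p = c"
proof -
  have sub: "{j. c j \<noteq> 0} \<subseteq> {..<n}"
    using assms(1) linorder_not_le by blast
  have "(\<Sum>j | c j \<noteq> 0. smult (c j) (cheb_V j)) = (\<Sum>j<n. smult (c j) (cheb_V j))"
    by (rule sum.mono_neutral_left) (use sub in auto)
  with sub assms(2) show ?thesis
    unfolding cheb_V_coeffs_def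
    by (intro the1_equality[OF ex1_V_coeffs]) (auto intro: finite_subset)
qed

text \<open>Stated for all large \<open>n\<close> so that the expansions of two polynomials can be
  cut off at a common index.\<close>

lemma eventually_cheb_V_expansion:
  "\<forall>\<^sub>F n in sequentially. (\<forall>j\<ge>n. cheb_V_coeffs p j = 0)
     \<and> p = (\<Sum>j<n. smult (cheb_V_coeffs p j) (cheb_V j))"
proof -
  let ?n = "Suc (degree p)"
  obtain c where c: "\<forall>j\<ge>?n. c j = 0" "p = (\<Sum>j<?n. smult (c j) (cheb_V j))"
    using cheb_V_span[of ?n p] by (auto simp: coeff_eq_0)
  have eq: "cheb_V_coeffs p = c" using c by (intro cheb_V_coeffs_eqI) auto
  have "(\<Sum>j<?n. smult (c j) (cheb_V j)) = (\<Sum>j<N. smult (c j) (cheb_V j))" if "N \<ge> ?n" for N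
    using c(1) that by (intro sum.mono_neutral_left) auto
  with c show ?thesis
    unfolding eq eventually_sequentially by (intro exI[of _ ?n]) auto
qed

lemma cheb_V_expansion:
  obtains n where "\<And>j. j \<ge> n \<Longrightarrow> cheb_V_coeffs p j = 0"
    and "p = (\<Sum>j<n. smult (cheb_V_coeffs p j) (cheb_V j))"
  using eventually_happens[OF eventually_cheb_V_expansion[of p]] by auto

lemma cheb_V_coeffs_add: "cheb_V_coeffs (p + q) = (\<lambda>j. cheb_V_coeffs p j + cheb_V_coeffs q j)"
proof -
  obtain n where n: "\<forall>j\<ge>n. cheb_V_coeffs p j = 0" "p = (\<Sum>j<n. smult (cheb_V_coeffs p j) (cheb_V j))"
    "\<forall>j\<ge>n. cheb_V_coeffs q j = 0" "q = (\<Sum>j<n. smult (cheb_V_coeffs q j) (cheb_V j))"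
    using eventually_happens[OF eventually_conj[OF eventually_cheb_V_expansion[of p]
      eventually_cheb_V_expansion[of q]]] by auto
  show ?thesis
  proof (rule cheb_V_coeffs_eqI[of n])
    show "p + q = (\<Sum>j<n. smult (cheb_V_coeffs p j + cheb_V_coeffs q j) (cheb_V j))"
      using n(2,4) by (simp add: smult_add_left sum.distrib)
  qed (use n in auto)
qed

lemma cheb_V_coeffs_smult: "cheb_V_coeffs (smult a p) = (\<lambda>j. a * cheb_V_coeffs p j)"
proof -
  obtain n where n: "\<And>j. j \<ge> n \<Longrightarrow> cheb_V_coeffs p j = 0"
    "p = (\<Sum>j<n. smult (cheb_V_coeffs p j) (cheb_V j))"
    using cheb_V_expansion[of p] by blast
  show ?thesis
  proof (rule cheb_V_coeffs_eqI[of n])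
    have "smult a p = smult a (\<Sum>j<n. smult (cheb_V_coeffs p j) (cheb_V j))"
      using n(2) by simp
    also have "\<dots> = (\<Sum>j<n. smult (a * cheb_V_coeffs p j) (cheb_V j))"
      by (induction n) (simp_all add: smult_add_right)
    finally show "smult a p = (\<Sum>j<n. smult (a * cheb_V_coeffs p j) (cheb_V j))" .
  qed (use n(1) in auto)
qed

lemma cheb_V_coeffs_cheb_V: "cheb_V_coeffs (cheb_V i) = (\<lambda>j. if j = i then 1 else 0)"
  by (rule cheb_V_coeffs_eqI[of "Suc i"]) (auto simp: if_distrib[of "\<lambda>c. smult c _"] cong: if_cong)

lemma cheb_V_coeffs_0: "cheb_V_coeffs 0 = (\<lambda>j. 0)"
  by (rule cheb_V_coeffs_eqI[of 0]) auto

definition cheb_V_nonneg :: "real poly \<Rightarrow> bool" where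
  "cheb_V_nonneg p \<longleftrightarrow> (\<forall>j. cheb_V_coeffs p j \<ge> 0)"

lemma cheb_V_nonneg_0: "cheb_V_nonneg 0"
  by (simp add: cheb_V_nonneg_def cheb_V_coeffs_0)

lemma cheb_V_nonneg_cheb_V: "cheb_V_nonneg (cheb_V i)"
  by (simp add: cheb_V_nonneg_def cheb_V_coeffs_cheb_V)

lemma cheb_V_nonneg_add: "cheb_V_nonneg p \<Longrightarrow> cheb_V_nonneg q \<Longrightarrow> cheb_V_nonneg (p + q)"
  by (simp add: cheb_V_nonneg_def cheb_V_coeffs_add)

lemma cheb_V_nonneg_smult: "a \<ge> 0 \<Longrightarrow> cheb_V_nonneg p \<Longrightarrow> cheb_V_nonneg (smult a p)"
  by (simp add: cheb_V_nonneg_def cheb_V_coeffs_smult)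

lemma cheb_V_nonneg_sum:
  "(\<And>i. i \<in> I \<Longrightarrow> cheb_V_nonneg (f i)) \<Longrightarrow> cheb_V_nonneg (sum f I)"
  by (induction I rule: infinite_finite_induct) (auto intro: cheb_V_nonneg_add cheb_V_nonneg_0)

text \<open>At \<open>x = 2 cos t\<close> this is \<open>sin ((i+2)t) sin ((j+2)t) - sin ((i+1)t)
  sin ((j+1)t) = sin ((i+j+3)t) sin t\<close>. It is one step of expanding a product in the
  basis.\<close>

lemma cheb_V_Suc_mult_Suc:
  "cheb_V (Suc i) * cheb_V (Suc j) = cheb_V (Suc (Suc (i + j))) + cheb_V i * cheb_V j"
proof (induction i arbitrary: j)
  case 0
  show ?case by (simp add: cheb_V_0 cheb_V_1 cheb_V_Suc_Suc)
next
  case (Suc i)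
  show ?case
  proof (cases j)
    case 0
    then show ?thesis by (simp add: cheb_V_0 cheb_V_1 cheb_V_Suc_Suc)
  next
    case j: (Suc l)
    let ?x = "[:0, 1:] :: real poly"
    have "cheb_V (Suc (Suc i)) * cheb_V (Suc j)
      = ?x * (cheb_V (Suc i) * cheb_V (Suc j)) - cheb_V i * cheb_V (Suc j)"
      unfolding cheb_V_Suc_Suc[of i] by (simp only: algebra_simps)
    also have "\<dots> = ?x * cheb_V (Suc (Suc (i + j))) + cheb_V i * (?x * cheb_V (Suc l) - cheb_V (Suc j))"
      unfolding Suc j by (simp only: algebra_simps)
    also have "?x * cheb_V (Suc l) - cheb_V (Suc j) = cheb_V l"
      unfolding j cheb_V_Suc_Suc by simp
    also have "?x * cheb_V (Suc (Suc (i + j))) + cheb_V i * cheb_V l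
       = cheb_V (Suc (Suc (Suc i + j))) + (cheb_V (Suc (Suc (i + l))) + cheb_V i * cheb_V l)"
      unfolding j using cheb_V_Suc_Suc[of "Suc (Suc (i + l))"] by simp
    also have "cheb_V (Suc (Suc (i + l))) + cheb_V i * cheb_V l = cheb_V (Suc i) * cheb_V j"
      unfolding j Suc ..
    finally show ?thesis .
  qed
qed

lemma cheb_V_nonneg_mult:
  assumes "cheb_V_nonneg p" "cheb_V_nonneg q"
  shows "cheb_V_nonneg (p * q)"
proof -
  \<comment> \<open>Lowering both indices until one of them is 0 writes the product as a sum of
    basis elements.\<close>
  have V: "cheb_V_nonneg (cheb_V i * cheb_V j)" for i j
  proof (induction i arbitrary: j)
    case 0
    show ?case by (simp add: cheb_V_0 cheb_V_nonneg_cheb_V)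
  next
    case (Suc i)
    show ?case
      by (cases j) (auto simp: cheb_V_0 cheb_V_Suc_mult_Suc
          intro!: cheb_V_nonneg_cheb_V cheb_V_nonneg_add Suc)
  qed
  let ?c = cheb_V_coeffs
  obtain m where m: "p = (\<Sum>i<m. smult (?c p i) (cheb_V i))"
    using cheb_V_expansion[of p] by blast
  obtain n where n: "q = (\<Sum>j<n. smult (?c q j) (cheb_V j))"
    using cheb_V_expansion[of q] by blast
  have "p * q = (\<Sum>i<m. \<Sum>j<n. smult (?c p i * ?c q j) (cheb_V i * cheb_V j))"
    by (subst m, subst n) (simp add: sum_product mult.commute)
  moreover have "cheb_V_nonneg \<dots>"
    using assms unfolding cheb_V_nonneg_def[of p] cheb_V_nonneg_def[of q]
    by (intro cheb_V_nonneg_sum cheb_V_nonneg_smult V) simp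
  ultimately show ?thesis by simp
qed

text \<open>This is the coefficient form of \<open>1 / (1 - (x + s) t + t\<^sup>2) = G + s t G / (1 - (x + s) t + t\<^sup>2)\<close>
  for the generating function \<open>G = 1 / (1 - x t + t\<^sup>2)\<close> of the polynomials \<open>cheb_V j\<close>.\<close>

lemma cheb_V_shift:
  "pcompose (cheb_V j) [:s, 1:]
     = cheb_V j + smult s (\<Sum>i<j. cheb_V i * pcompose (cheb_V (j - 1 - i)) [:s, 1:])"
proof (induction j rule: cheb_U.induct)
  case 1
  show ?case by (simp add: cheb_V_0 pcompose_1)
next
  case 2
  show ?case by (simp add: cheb_V_1 cheb_V_0 pcompose_1 pcompose_pCons)
next
  case (3 j)
  let ?W = "\<lambda>j. pcompose (cheb_V j) [:s, 1:]"
  let ?R = "\<lambda>j. \<Sum>i<j. cheb_V i * ?W (j - 1 - i)"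
  let ?x = "[:0, 1:] :: real poly"
  have W: "?W (Suc (Suc j)) = ?x * ?W (Suc j) + smult s (?W (Suc j)) - ?W j" for j
    by (simp add: cheb_V_Suc_Suc pcompose_diff pcompose_mult pcompose_pCons)
  have R: "?R (Suc (Suc j)) = ?W (Suc j) + ?x * ?R (Suc j) - ?R j"
  proof -
    have "?R (Suc (Suc j)) = ?W (Suc j) + (\<Sum>i<Suc j. cheb_V (Suc i) * ?W (j - i))"
      by (subst sum.lessThan_Suc_shift) (simp add: cheb_V_0)
    also have "(\<Sum>i<Suc j. cheb_V (Suc i) * ?W (j - i))
       = ?x * ?W j + (\<Sum>i<j. cheb_V (Suc (Suc i)) * ?W (j - Suc i))"
      by (subst sum.lessThan_Suc_shift) (simp add: cheb_V_1)
    also have "(\<Sum>i<j. cheb_V (Suc (Suc i)) * ?W (j - Suc i))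
       = ?x * (\<Sum>i<j. cheb_V (Suc i) * ?W (j - Suc i)) - ?R j"
      by (simp add: cheb_V_Suc_Suc left_diff_distrib sum_subtractf sum_distrib_left mult.assoc
          del: mult_pCons_left)
    also have "?x * ?W j + (?x * (\<Sum>i<j. cheb_V (Suc i) * ?W (j - Suc i)) - ?R j)
       = ?x * ?R (Suc j) - ?R j"
      by (simp add: sum.lessThan_Suc_shift[of _ j] cheb_V_0 distrib_left
          del: mult_pCons_left sum.lessThan_Suc)
    finally show ?thesis by (simp only: add_diff_eq)
  qed
  have "?W (Suc (Suc j)) = smult s (?W (Suc j)) + ?x * ?W (Suc j) - ?W j"
    unfolding W by simp
  also have "?x * ?W (Suc j) = ?x * cheb_V (Suc j) + smult s (?x * ?R (Suc j))"
    by (subst 3(1)) (simp only: distrib_left mult_smult_right)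
  also have "smult s (?W (Suc j)) + \<dots> - ?W j
     = smult s (?W (Suc j)) + (?x * cheb_V (Suc j) + smult s (?x * ?R (Suc j))) - (cheb_V j + smult s (?R j))"
    using 3(2) by (simp only:)
  also have "\<dots> = cheb_V (Suc (Suc j)) + smult s (?R (Suc (Suc j)))"
    unfolding R cheb_V_Suc_Suc[of j] by (simp only: smult_add_right smult_diff_right algebra_simps)
  finally show ?case .
qed

text \<open>On the right of \<open>cheb_V_shift\<close> only shifts of polynomials of smaller index
  occur, so strong induction applies.\<close>

lemma cheb_V_nonneg_shift:
  assumes "s \<ge> 0"
  shows "cheb_V_nonneg (pcompose (cheb_V j) [:s, 1:])"
proof (induction j rule: less_induct)
  case (less j)
  show ?case
    by (subst cheb_V_shift)
      (auto intro!: cheb_V_nonneg_add cheb_V_nonneg_smult cheb_V_nonneg_sum cheb_V_nonneg_mult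
        cheb_V_nonneg_cheb_V less assms)
qed

text \<open>The summand \<open>i = 0\<close> of \<open>cheb_V_shift\<close> is \<open>s\<close>
  times the shift of the preceding polynomial. It carries the positive coefficient of
  \<open>cheb_V 0\<close>; everything else lies in the cone.\<close>

lemma cheb_V_coeffs_shift_0_pos:
  assumes "s > 0"
  shows "cheb_V_coeffs (pcompose (cheb_V j) [:s, 1:]) 0 > 0"
proof (induction j)
  case 0
  show ?case using cheb_V_coeffs_cheb_V[of 0] by (simp add: cheb_V_0 pcompose_1)
next
  case (Suc j)
  let ?W = "\<lambda>j. pcompose (cheb_V j) [:s, 1:]"
  let ?r = "cheb_V (Suc j) + smult s (\<Sum>i<j. cheb_V (Suc i) * ?W (j - Suc i))"
  have "cheb_V_nonneg ?r"
    using assms by (intro cheb_V_nonneg_add cheb_V_nonneg_smult cheb_V_nonneg_sum cheb_V_nonneg_mult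
        cheb_V_nonneg_cheb_V cheb_V_nonneg_shift) auto
  moreover have "?W (Suc j) = smult s (?W j) + ?r"
    by (subst cheb_V_shift, subst sum.lessThan_Suc_shift) (simp add: cheb_V_0 smult_add_right)
  ultimately show ?case
    using Suc assms by (simp add: cheb_V_coeffs_add cheb_V_coeffs_smult cheb_V_nonneg_def add_pos_nonneg)
qed

section \<open>Factorisation of \<open>F_poly\<close> and the expansion of
  \<open>F_hat\<close>\<close>

lemma F_poly_eq_square: "F_poly m = cheb_V m * cheb_V m"
proof (induction m)
  case 0
  show ?case by (simp add: F_poly_def cheb_V_0)
next
  case (Suc m)
  have "F_poly (Suc m) = F_poly m + cheb_V (2 * Suc m)" by (simp add: F_poly_def)
  \<comment> \<open>The product rule with both indices \<open>m\<close> says that consecutive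
    squares differ by \<open>cheb_V (2 * Suc m)\<close>.\<close>
  with Suc show ?case using cheb_V_Suc_mult_Suc[of m m] by (simp add: mult_2)
qed

text \<open>The recurrence, used once in \<open>x\<close> and once in \<open>y\<close>, makes the
  sum telescope. At a root \<open>y\<close> of \<open>cheb_V (Suc n)\<close> it yields the cofactor
  of \<open>x - y\<close>, up to the scalar \<open>poly (cheb_V n) y\<close>.\<close>

lemma christoffel_darboux:
  "[:-y, 1:] * (\<Sum>j<Suc n. smult (poly (cheb_V j) y) (cheb_V j))
     = smult (poly (cheb_V n) y) (cheb_V (Suc n)) - smult (poly (cheb_V (Suc n)) y) (cheb_V n)"
proof (induction n)
  case 0
  show ?case by (simp add: cheb_V_0 cheb_V_1)
next
  case (Suc n)
  have x: "[:-y, 1:] * p = [:0, 1:] * p - smult y p" for p by simp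
  have "[:-y, 1:] * smult (poly (cheb_V (Suc n)) y) (cheb_V (Suc n))
    = smult (poly (cheb_V (Suc n)) y) (cheb_V (Suc (Suc n)) + cheb_V n)
      - smult (poly (cheb_V (Suc (Suc n))) y + poly (cheb_V n) y) (cheb_V (Suc n))"
    unfolding x by (simp add: cheb_V_Suc_Suc algebra_simps)
  thus ?case
    unfolding sum.lessThan_Suc[of _ "Suc n"] distrib_left Suc
    by (simp add: smult_add_left smult_add_right)
qed

text \<open>With \<open>t = pi / (m + 1)\<close> the value is \<open>sin ((j+1)t) / sin t\<close>.
  The angle lies between 0 and \<open>pi\<close>, and for \<open>j = m - 1\<close> it is
  \<open>pi - t\<close>.\<close>

lemma cheb_V_alpha_pos:
  assumes "j < m"
  shows "poly (cheb_V j) (alpha m) > 0"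
    and cheb_V_alpha_pred: "Suc j = m \<Longrightarrow> poly (cheb_V j) (alpha m) = 1"
proof -
  define t where "t = pi / real (m + 1)"
  have t: "0 < t" "t < pi" "real (m + 1) * t = pi"
    using assms by (auto simp: t_def field_simps)
  have sin: "sin t > 0" using t by (intro sin_gt_zero) auto
  have eq: "poly (cheb_V j) (alpha m) * sin t = sin (real (j + 1) * t)"
    using cheb_U_cos_mult_sin[of j t] by (simp add: poly_cheb_V alpha_def t_def)
  have "real (j + 1) * t < real (m + 1) * t" using assms t by (intro mult_strict_right_mono) auto
  moreover have "real (j + 1) * t > 0" using t by simp
  ultimately have "sin (real (j + 1) * t) > 0" unfolding t(3) by (intro sin_gt_zero)
  with eq sin show "poly (cheb_V j) (alpha m) > 0" by (metis zero_less_mult_pos2)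
  assume "Suc j = m"
  hence "real (j + 1) * t = pi - t" using t(3) by (auto simp: algebra_simps)
  with eq sin show "poly (cheb_V j) (alpha m) = 1" by simp
qed

lemma pCons_one_nonzero: "[:a, 1:] \<noteq> (0 :: real poly)"
  by simp

text \<open>At \<open>alpha m\<close> the polynomial \<open>cheb_V m\<close> vanishes and its
  predecessor has value 1, so the Christoffel-Darboux sum is exactly the cofactor of
  \<open>x - alpha m\<close> in one of the two factors of \<open>F_poly m\<close>.\<close>

lemma F_hat_expansion:
  assumes "m > 0"
  shows "F_hat m = (\<Sum>j<m. smult (poly (cheb_V j) (alpha m)) (cheb_V j)) * cheb_V m"
proof -
  obtain n where m: "m = Suc n" using assms by (cases m) auto
  have "[:- alpha m, 1:] * (\<Sum>j<m. smult (poly (cheb_V j) (alpha m)) (cheb_V j)) = cheb_V m"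
  proof -
    have "poly (cheb_V n) (alpha m) = 1" by (rule cheb_V_alpha_pred) (simp_all add: m)
    with christoffel_darboux[of "alpha m" n] alpha_largest_root_V(1)[OF assms]
    show ?thesis unfolding m[symmetric] by (simp only: smult_1_left smult_0_left diff_0_right)
  qed
  hence "F_poly m = [:- alpha m, 1:]
      * ((\<Sum>j<m. smult (poly (cheb_V j) (alpha m)) (cheb_V j)) * cheb_V m)"
    unfolding F_poly_eq_square mult.assoc[symmetric] by simp
  thus ?thesis using F_eq_mult_F_hat[OF assms]
    by (simp only: mult_left_cancel[OF pCons_one_nonzero])
qed

text \<open>The summand \<open>j = 0\<close> of the expansion has coefficient 1 and contributes the
  shifted \<open>cheb_V m\<close> itself, which makes the coefficient at 0 strictly positive; the
  other summands lie in the cone.\<close>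

lemma
  assumes "m > 0" and "s > 0"
  shows cheb_V_nonneg_F_hat_shift: "cheb_V_nonneg (pcompose (F_hat m) [:s, 1:])" (is ?nonneg)
    and cheb_V_coeffs_F_hat_shift_0_pos: "cheb_V_coeffs (pcompose (F_hat m) [:s, 1:]) 0 > 0" (is ?pos)
proof -
  obtain n where m: "m = Suc n" using assms by (cases m) auto
  let ?W = "\<lambda>j. pcompose (cheb_V j) [:s, 1:]"
  let ?r = "(\<Sum>j<n. smult (poly (cheb_V (Suc j)) (alpha m)) (?W (Suc j))) * ?W m"
  have eq: "pcompose (F_hat m) [:s, 1:] = ?W m + ?r"
    unfolding F_hat_expansion[OF assms(1)]
    by (simp add: m sum.lessThan_Suc_shift pcompose_mult pcompose_add pcompose_sum pcompose_smult
        distrib_right cheb_V_0 pcompose_1 del: sum.lessThan_Suc)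
  have W: "cheb_V_nonneg (?W j)" for j using assms cheb_V_nonneg_shift by simp
  have r: "cheb_V_nonneg ?r"
    using cheb_V_alpha_pos[of _ m]
    by (intro cheb_V_nonneg_mult cheb_V_nonneg_sum cheb_V_nonneg_smult W) (auto simp: m less_imp_le)
  show ?nonneg unfolding eq by (intro cheb_V_nonneg_add W r)
  show ?pos using r cheb_V_coeffs_shift_0_pos[OF assms(2), of m]
    by (simp add: eq cheb_V_coeffs_add cheb_V_nonneg_def add_pos_nonneg)
qed

lemma poly_F_hat_nonpos:
  assumes "m > 0" and "x < alpha m"
  shows "poly (F_hat m) x \<le> 0"
proof -
  have "(x - alpha m) * poly (F_hat m) x = (poly (cheb_V m) x)\<^sup>2"
    using arg_cong[OF F_eq_mult_F_hat[OF assms(1)], of "\<lambda>p. poly p x"]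
    by (simp add: F_poly_eq_square power2_eq_square algebra_simps)
  hence "(x - alpha m) * poly (F_hat m) x \<ge> 0" by simp
  with assms(2) show ?thesis by (simp add: zero_le_mult_iff)
qed

text \<open>Evaluated at \<open>L\<close>, this makes the final bound nonnegative.\<close>

lemma poly_nonneg_of_cheb_V_nonneg:
  assumes "cheb_V_nonneg p" and "x \<ge> 2"
  shows "poly p x \<ge> 0"
proof -
  obtain n where n: "p = (\<Sum>j<n. smult (cheb_V_coeffs p j) (cheb_V j))"
    using cheb_V_expansion[of p] by blast
  have "poly p x = (\<Sum>j<n. cheb_V_coeffs p j * poly (cheb_V j) x)"
    by (subst n) (simp add: poly_sum)
  also have "\<dots> \<ge> 0"
    using assms cheb_V_gt_2[OF assms(2)] by (intro sum_nonneg mult_nonneg_nonneg)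
      (auto simp: cheb_V_nonneg_def less_imp_le)
  finally show ?thesis .
qed

section \<open>Traces and eigenvalues\<close>

text \<open>For \<open>r = q\<^sup>2\<close> this is \<open>q ^ j\<close> times
  \<open>cheb_V j\<close> at \<open>A / q\<close>. The scaling keeps the recursion free of division,
  so that for \<open>r = k - 1\<close> its entries can be walk counts.\<close>

fun cheb_mat :: "'a :: comm_ring_1 \<Rightarrow> 'a mat \<Rightarrow> nat \<Rightarrow> 'a mat" where
  "cheb_mat r A 0 = 1\<^sub>m (dim_row A)"
| "cheb_mat r A (Suc 0) = A"
| "cheb_mat r A (Suc (Suc j)) = A * cheb_mat r A (Suc j) - r \<cdot>\<^sub>m cheb_mat r A j"

lemma cheb_mat_carrier: "A \<in> carrier_mat n n \<Longrightarrow> cheb_mat r A j \<in> carrier_mat n n"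
  by (induction r A j rule: cheb_mat.induct) auto

lemma cheb_mat_similar:
  assumes "similar_mat_wit A B P Q"
  shows "cheb_mat r A j = P * cheb_mat r B j * Q"
proof -
  obtain n where c: "A \<in> carrier_mat n n" "B \<in> carrier_mat n n" "P \<in> carrier_mat n n" "Q \<in> carrier_mat n n"
    and PQ: "P * Q = 1\<^sub>m n" "Q * P = 1\<^sub>m n" and A: "A = P * B * Q"
    using assms unfolding similar_mat_wit_def Let_def by auto
  show ?thesis
  proof (induction j rule: cheb_U.induct)
    case 1
    show ?case using c PQ by simp
  next
    case 2
    show ?case using A by simp
  next
    case (3 j)
    let ?S = "cheb_mat r B (Suc j)" and ?R = "cheb_mat r B j"
    note S = cheb_mat_carrier[OF c(2), of r "Suc j"] and R = cheb_mat_carrier[OF c(2), of r j]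
    have "A * (P * ?S * Q) = P * B * (Q * P) * ?S * Q"
      unfolding A using c S by (simp add: assoc_mult_mat[of _ n n _ n _ n])
    also have "\<dots> = P * (B * ?S) * Q"
      unfolding PQ using c S by (simp add: assoc_mult_mat[of _ n n _ n _ n])
    finally have 1: "A * (P * ?S * Q) = P * (B * ?S) * Q" .
    have 2: "r \<cdot>\<^sub>m (P * ?R * Q) = P * (r \<cdot>\<^sub>m ?R) * Q"
      using c R by (simp add: mult_smult_distrib[of _ n n _ n] mult_smult_assoc_mat[of _ n n _ n])
    have "P * (B * ?S - r \<cdot>\<^sub>m ?R) * Q = P * (B * ?S) * Q - P * (r \<cdot>\<^sub>m ?R) * Q"
      using c S R by (simp add: mult_minus_distrib_mat[of _ n n _ n] minus_mult_distrib_mat[of _ n n _ _ n])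
    with 1 2 3 show ?case by simp
  qed
qed

lemma trace_mult_commute:
  fixes X Y :: "'a :: comm_semiring_0 mat"
  assumes "X \<in> carrier_mat n n" "Y \<in> carrier_mat n n"
  shows "(\<Sum>i<n. (X * Y) $$ (i, i)) = (\<Sum>i<n. (Y * X) $$ (i, i))"
proof -
  have "(\<Sum>i<n. (X * Y) $$ (i, i)) = (\<Sum>i<n. \<Sum>j<n. X $$ (i, j) * Y $$ (j, i))"
    using assms by (auto simp: scalar_prod_def lessThan_atLeast0)
  also have "\<dots> = (\<Sum>j<n. \<Sum>i<n. Y $$ (j, i) * X $$ (i, j))"
    by (subst sum.swap) (simp add: mult.commute)
  also have "\<dots> = (\<Sum>i<n. (Y * X) $$ (i, i))"
    using assms by (auto simp: scalar_prod_def lessThan_atLeast0)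
  finally show ?thesis .
qed

lemma trace_similar:
  fixes B :: "'a :: comm_semiring_1 mat"
  assumes "B \<in> carrier_mat n n" "P \<in> carrier_mat n n" "Q \<in> carrier_mat n n" "Q * P = 1\<^sub>m n"
  shows "(\<Sum>i<n. (P * B * Q) $$ (i, i)) = (\<Sum>i<n. B $$ (i, i))"
proof -
  have "(\<Sum>i<n. (P * B * Q) $$ (i, i)) = (\<Sum>i<n. (P * (B * Q)) $$ (i, i))"
    using assms by (simp add: assoc_mult_mat[of _ n n _ n _ n])
  also have "\<dots> = (\<Sum>i<n. (B * Q * P) $$ (i, i))"
    using assms by (intro trace_mult_commute) auto
  also have "B * Q * P = B" using assms by (simp add: assoc_mult_mat[of _ n n _ n _ n])
  finally show ?thesis .
qed

text \<open>Diagonals of upper triangular matrices multiply entrywise, so a polynomial in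
  \<open>B\<close> acts on each diagonal entry separately.\<close>

lemma cheb_mat_upper_triangular:
  fixes B :: "real mat"
  assumes B: "B \<in> carrier_mat n n" "upper_triangular B" and q: "q \<noteq> 0"
  shows "upper_triangular (cheb_mat (q\<^sup>2) B j)
    \<and> (\<forall>i<n. cheb_mat (q\<^sup>2) B j $$ (i, i) = q ^ j * poly (cheb_V j) (B $$ (i, i) / q))"
proof (induction j rule: cheb_U.induct)
  case 1
  show ?case using B by (auto simp: cheb_V_0)
next
  case 2
  show ?case using B q by (auto simp: cheb_V_1)
next
  case (3 j)
  let ?S = "cheb_mat (q\<^sup>2) B (Suc j)" and ?R = "cheb_mat (q\<^sup>2) B j"
  note S = cheb_mat_carrier[OF B(1), of "q\<^sup>2" "Suc j"] and R = cheb_mat_carrier[OF B(1), of "q\<^sup>2" j]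
  have ent: "(B * ?S) $$ (i, l) = (\<Sum>a<n. B $$ (i, a) * ?S $$ (a, l))" if "i < n" "l < n" for i l
    using that B S by (auto simp: scalar_prod_def lessThan_atLeast0)
  have low: "B $$ (i, a) * ?S $$ (a, l) = 0" if "i < n" "a < n" "l \<le> i" "a \<noteq> i \<or> l \<noteq> i" for i a l
  proof (cases "a < i")
    case True
    then show ?thesis using that B by (simp add: upper_triangularD[OF B(2)])
  next
    case False
    with that have "l < a" by auto
    then show ?thesis using that S 3(1) upper_triangularD[of ?S l a] by simp
  qed
  show ?case
  proof (intro conjI upper_triangularI allI impI)
    fix i l assume "l < i" "i < dim_row (cheb_mat (q\<^sup>2) B (Suc (Suc j)))"
    hence il: "l < i" "i < n" using B R by auto
    have "(B * ?S) $$ (i, l) = 0"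
      using il by (subst ent) (auto simp del: mult_eq_0_iff intro!: sum.neutral low)
    moreover have "?R $$ (i, l) = 0" using il 3(2) R upper_triangularD[of ?R l i] by simp
    ultimately show "cheb_mat (q\<^sup>2) B (Suc (Suc j)) $$ (i, l) = 0"
      using il R S B by simp
  next
    fix i assume i: "i < n"
    have "(\<Sum>a<n. B $$ (i, a) * ?S $$ (a, i)) = (\<Sum>a<n. if a = i then B $$ (i, i) * ?S $$ (i, i) else 0)"
      using i low by (intro sum.cong) auto
    hence "(B * ?S) $$ (i, i) = B $$ (i, i) * ?S $$ (i, i)"
      using i by (simp add: ent)
    hence "cheb_mat (q\<^sup>2) B (Suc (Suc j)) $$ (i, i) = B $$ (i, i) * ?S $$ (i, i) - q\<^sup>2 * ?R $$ (i, i)"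
      using i R S B by simp
    also have "\<dots> = q ^ Suc (Suc j) * poly (cheb_V (Suc (Suc j))) (B $$ (i, i) / q)"
      using 3 i q by (simp add: cheb_V_Suc_Suc field_simps power2_eq_square)
    finally show "cheb_mat (q\<^sup>2) B (Suc (Suc j)) $$ (i, i)
      = q ^ Suc (Suc j) * poly (cheb_V (Suc (Suc j))) (B $$ (i, i) / q)" .
  qed
qed

text \<open>Schur decomposition puts the eigenvalues on the diagonal of a triangular matrix, and
  similarity preserves the trace.\<close>

lemma sum_list_cheb_V_eq_trace:
  fixes A :: "real mat"
  assumes A: "A \<in> carrier_mat n n" and es: "char_poly A = (\<Prod>e\<leftarrow>es. [:- e, 1:])" and q: "q \<noteq> 0"
  shows "q ^ j * (\<Sum>e\<leftarrow>es. poly (cheb_V j) (e / q)) = (\<Sum>i<n. cheb_mat (q\<^sup>2) A j $$ (i, i))"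
proof -
  obtain B P Q where "schur_decomposition A es = (B, P, Q)" by (cases "schur_decomposition A es") auto
  from schur_decomposition[OF A es this]
  have sim: "similar_mat_wit A B P Q" and up: "upper_triangular B" and es_eq: "diag_mat B = es" by auto
  from sim A have c: "B \<in> carrier_mat n n" "P \<in> carrier_mat n n" "Q \<in> carrier_mat n n"
    and QP: "Q * P = 1\<^sub>m n"
    by (auto simp: similar_mat_wit_def Let_def)
  have "(\<Sum>i<n. cheb_mat (q\<^sup>2) A j $$ (i, i)) = (\<Sum>i<n. cheb_mat (q\<^sup>2) B j $$ (i, i))"
    unfolding cheb_mat_similar[OF sim] by (rule trace_similar[OF cheb_mat_carrier[OF c(1)] c(2,3) QP])
  also have "\<dots> = q ^ j * (\<Sum>i<n. poly (cheb_V j) (B $$ (i, i) / q))"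
    using cheb_mat_upper_triangular[OF c(1) up q, of j] by (simp add: sum_distrib_left)
  also have "(\<Sum>i<n. poly (cheb_V j) (B $$ (i, i) / q)) = (\<Sum>e\<leftarrow>es. poly (cheb_V j) (e / q))"
    using c(1) by (simp add: es_eq[symmetric] diag_mat_def comp_def interv_sum_list_conv_sum_set_nat
        lessThan_atLeast0)
  finally show ?thesis by simp
qed

section \<open>Reality of the eigenvalues of a symmetric matrix\<close>

lemma real_symmetric_char_poly_splits:
  fixes A :: "real mat"
  assumes A: "A \<in> carrier_mat n n" and sym: "\<And>i j. i < n \<Longrightarrow> j < n \<Longrightarrow> A $$ (i, j) = A $$ (j, i)"
  obtains es where "char_poly A = (\<Prod>e\<leftarrow>es. [:- e, 1:])" "length es = n"
proof -
  interpret c: inj_idom_hom complex_of_real by unfold_locales auto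
  interpret cp: map_poly_inj_idom_hom complex_of_real ..
  let ?A = "map_mat complex_of_real A"
  have cA: "?A \<in> carrier_mat n n" using A by simp
  obtain as where as: "char_poly ?A = (\<Prod>a\<leftarrow>as. [:- a, 1:])" "length as = n"
    using char_poly_factorized[OF cA] by blast
  have real: "complex_of_real (Re a) = a" if "a \<in> set as" for a
  proof -
    have "poly (char_poly ?A) a = 0"
      unfolding as using that by (auto simp: poly_prod_list prod_list_zero_iff)
    then obtain v where "eigenvector ?A v a"
      using eigenvalue_root_char_poly[OF cA] by (auto simp: eigenvalue_def)
    hence v: "v \<in> carrier_vec n" "v \<noteq> 0\<^sub>v n" "?A *\<^sub>v v = a \<cdot>\<^sub>v v"
      using A by (auto simp: eigenvector_def)
    have ev: "(\<Sum>j<n. complex_of_real (A $$ (i, j)) * v $ j) = a * v $ i" if "i < n" for i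
      using arg_cong[OF v(3), of "\<lambda>x. x $ i"] that A v(1)
      by (auto simp: scalar_prod_def lessThan_atLeast0)
    \<comment> \<open>\<open>S\<close> is the Hermitian form of \<open>A\<close> at \<open>v\<close>
      and \<open>N\<close> the squared norm of \<open>v\<close>. The eigenvalue equation gives
      \<open>S = a N\<close>, while symmetry makes \<open>S\<close> equal to its conjugate.\<close>
    define S where "S = (\<Sum>i<n. \<Sum>j<n. cnj (v $ i) * (complex_of_real (A $$ (i, j)) * v $ j))"
    define N where "N = (\<Sum>i<n. (cmod (v $ i))\<^sup>2)"
    have "S = (\<Sum>i<n. cnj (v $ i) * (\<Sum>j<n. complex_of_real (A $$ (i, j)) * v $ j))"
      by (simp add: S_def sum_distrib_left)
    also have "\<dots> = (\<Sum>i<n. a * complex_of_real ((cmod (v $ i))\<^sup>2))"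
      by (intro sum.cong refl) (simp add: ev del: of_real_power,
          simp add: complex_norm_square mult_ac del: of_real_power)
    finally have "S = (\<Sum>i<n. a * complex_of_real ((cmod (v $ i))\<^sup>2))" .
    hence S: "S = a * complex_of_real N" by (simp add: N_def sum_distrib_left)
    have "cnj S = (\<Sum>i<n. \<Sum>j<n. cnj (v $ j) * (complex_of_real (A $$ (j, i)) * v $ i))"
      unfolding S_def using sym by (simp add: cnj_sum mult_ac)
    also have "\<dots> = S" unfolding S_def by (rule sum.swap)
    finally have "cnj a * complex_of_real N = a * complex_of_real N" unfolding S by simp
    moreover have "N \<noteq> 0"
    proof
      assume "N = 0"
      hence "\<forall>i<n. v $ i = 0" unfolding N_def by (subst (asm) sum_nonneg_eq_0_iff) auto
      with v(1,2) show False using eq_vecI[of v "0\<^sub>v n"] by auto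
    qed
    ultimately have "cnj a = a" by simp
    thus ?thesis by (simp add: complex_eq_iff)
  qed
  have "map_poly complex_of_real (char_poly A) = (\<Prod>a\<leftarrow>as. [:- a, 1:])"
    using of_real_hom.char_poly_hom[OF A, where ?'a = complex] as by simp
  also have "\<dots> = (\<Prod>a\<leftarrow>as. map_poly complex_of_real [:- Re a, 1:])"
    using real by (intro arg_cong[of _ _ prod_list] map_cong) auto
  also have "\<dots> = map_poly complex_of_real (\<Prod>e\<leftarrow>map Re as. [:- e, 1:])"
    by (simp add: cp.hom_prod_list comp_def)
  finally have "char_poly A = (\<Prod>e\<leftarrow>map Re as. [:- e, 1:])" by simp
  thus thesis using that[of "map Re as"] as(2) by simp
qed

section \<open>Non-backtracking walks\<close>

locale regular_matrix =
  fixes n k :: nat and a :: "nat \<Rightarrow> nat \<Rightarrow> real"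
  assumes a01: "\<And>i j. a i j = 0 \<or> a i j = 1"
    and a_sym: "\<And>i j. a i j = a j i"
    and row_sum: "\<And>i. i < n \<Longrightarrow> (\<Sum>j<n. a i j) = real k"
begin

text \<open>If \<open>u, v\<close> is an arc, \<open>nb_from j u v w\<close> is the number of non-backtracking walks from \<open>v\<close> to \<open>w\<close>
  with \<open>j\<close> arcs whose first step does not return to \<open>u\<close>; \<open>nb j u w\<close> counts all non-backtracking
  walks from \<open>u\<close> to \<open>w\<close> with \<open>j\<close> arcs, and \<open>nb_par j\<close> those with \<open>j, j - 2, \<dots>\<close> arcs.\<close>

fun nb_from :: "nat \<Rightarrow> nat \<Rightarrow> nat \<Rightarrow> nat \<Rightarrow> real" where
  "nb_from 0 u v w = of_bool (v = w)"
| "nb_from (Suc j) u v w = (\<Sum>x\<in>{..<n} - {u}. a v x * nb_from j v x w)"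

fun nb :: "nat \<Rightarrow> nat \<Rightarrow> nat \<Rightarrow> real" where
  "nb 0 u w = of_bool (u = w)"
| "nb (Suc j) u w = (\<Sum>v<n. a u v * nb_from j u v w)"

fun nb_par :: "nat \<Rightarrow> nat \<Rightarrow> nat \<Rightarrow> real" where
  "nb_par 0 u w = nb 0 u w"
| "nb_par (Suc 0) u w = nb (Suc 0) u w"
| "nb_par (Suc (Suc j)) u w = nb (Suc (Suc j)) u w + nb_par j u w"

lemma a_nonneg: "a i j \<ge> 0" using a01[of i j] by auto

lemma nb_from_nonneg: "nb_from j u v w \<ge> 0"
  by (induction j arbitrary: u v) (auto intro!: sum_nonneg mult_nonneg_nonneg a_nonneg)

lemma nb_par_nonneg: "nb_par j u w \<ge> 0"
  by (induction j rule: cheb_U.induct)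
    (auto intro!: sum_nonneg mult_nonneg_nonneg add_nonneg_nonneg a_nonneg nb_from_nonneg)

text \<open>A walk from \<open>v\<close> either avoids \<open>u\<close> in its first step or goes to
  \<open>u\<close> and then may not return to \<open>v\<close>.\<close>

lemma nb_Suc_split:
  assumes "u < n"
  shows "a u v * nb (Suc j) v w = a u v * (nb_from (Suc j) u v w + nb_from j v u w)"
proof -
  have "nb (Suc j) v w = nb_from (Suc j) u v w + a v u * nb_from j v u w"
    using assms by (simp add: sum.remove[of "{..<n}" u])
  thus ?thesis using a01[of u v] a_sym[of u v] by auto
qed

lemma nb_step:
  assumes "u < n"
  shows "nb (Suc (Suc j)) u w = (\<Sum>v<n. a u v * nb (Suc j) v w) - (\<Sum>v<n. a u v * nb_from j v u w)"
proof -
  have "(\<Sum>v<n. a u v * nb (Suc j) v w) = (\<Sum>v<n. a u v * nb_from (Suc j) u v w + a u v * nb_from j v u w)"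
    using nb_Suc_split[OF assms] by (simp only: distrib_left)
  thus ?thesis by (simp add: sum.distrib del: nb_from.simps)
qed

text \<open>At length 2 the correction is \<open>k\<close> rather than \<open>k - 1\<close>: going
  out and back is possible through each of the \<open>k\<close> neighbours.\<close>

lemma nb_2:
  assumes "u < n"
  shows "nb (Suc (Suc 0)) u w = (\<Sum>v<n. a u v * nb (Suc 0) v w) - real k * nb 0 u w"
  using row_sum[OF assms] unfolding nb_step[OF assms] by (simp add: sum_distrib_right[symmetric])

text \<open>The term subtracted in \<open>nb_step\<close> counts, for each neighbour
  \<open>v\<close> of \<open>u\<close>, the walks from \<open>u\<close> that do not start towards
  \<open>v\<close>. Each walk is counted once for every neighbour except its own first step.\<close>

lemma nb_Suc_Suc_Suc:
  assumes "u < n"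
  shows "nb (Suc (Suc (Suc j))) u w
    = (\<Sum>v<n. a u v * nb (Suc (Suc j)) v w) - (real k - 1) * nb (Suc j) u w"
proof -
  have "a u v * nb_from (Suc j) v u w = a u v * nb (Suc j) u w - a u v * nb_from j u v w" if "v < n" for v
    using nb_Suc_split[OF that, of u j w] a_sym[of u v] by (simp only: algebra_simps)
  hence "(\<Sum>v<n. a u v * nb_from (Suc j) v u w)
    = (\<Sum>v<n. a u v) * nb (Suc j) u w - (\<Sum>v<n. a u v * nb_from j u v w)"
    by (simp add: sum_subtractf sum_distrib_right del: nb_from.simps nb.simps)
  also have "\<dots> = (real k - 1) * nb (Suc j) u w"
    using row_sum[OF assms] by (simp add: algebra_simps)
  finally show ?thesis unfolding nb_step[OF assms] by simp
qed

text \<open>Adding the shorter walks of the same parity turns the exceptional \<open>k\<close> at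
  length 2 into \<open>k - 1\<close>, so one recursion, that of \<open>cheb_mat\<close>, holds at
  every length.\<close>

lemma nb_par_Suc_Suc:
  assumes "u < n"
  shows "nb_par (Suc (Suc j)) u w
    = (\<Sum>v<n. a u v * nb_par (Suc j) v w) - (real k - 1) * nb_par j u w"
proof (induction j rule: cheb_U.induct)
  case 1
  show ?case using nb_2[OF assms, of w] by (simp add: algebra_simps del: nb.simps)
next
  case 2
  have "(\<Sum>v<n. a u v * nb_par 0 v w) = nb (Suc 0) u w" by (simp add: mult.commute)
  thus ?case using nb_Suc_Suc_Suc[OF assms, of 0 w]
    by (simp add: algebra_simps sum.distrib del: nb.simps)
next
  case (3 j)
  show ?case using nb_Suc_Suc_Suc[OF assms, of "Suc j" w] 3(2)
    by (simp add: algebra_simps sum.distrib del: nb.simps)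
qed

lemma cheb_mat_eq_nb_par:
  assumes "u < n" "w < n"
  shows "cheb_mat (real k - 1) (mat n n (\<lambda>(i, j). a i j)) j $$ (u, w) = nb_par j u w"
  using assms
proof (induction j arbitrary: u rule: cheb_U.induct)
  case 1
  then show ?case by simp
next
  case 2
  then show ?case by (simp add: mult.commute)
next
  case (3 j)
  let ?A = "mat n n (\<lambda>(i, j). a i j)"
  have A: "?A \<in> carrier_mat n n" by simp
  note c = cheb_mat_carrier[OF A, of "real k - 1" "Suc j"] cheb_mat_carrier[OF A, of "real k - 1" j]
  have "(?A * cheb_mat (real k - 1) ?A (Suc j)) $$ (u, w) = (\<Sum>v<n. a u v * nb_par (Suc j) v w)"
    using 3 c by (auto simp: scalar_prod_def lessThan_atLeast0)
  with 3 c show ?case unfolding nb_par_Suc_Suc[OF 3(3)] by simp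
qed

section \<open>The largest eigenvalue of a regular matrix\<close>

lemma eigenvalue_le:
  assumes "eigenvalue (mat n n (\<lambda>(i, j). a i j)) e"
  shows "e \<le> real k"
proof -
  from assms obtain v where v: "v \<in> carrier_vec n" "v \<noteq> 0\<^sub>v n" "mat n n (\<lambda>(i, j). a i j) *\<^sub>v v = e \<cdot>\<^sub>v v"
    by (auto simp: eigenvalue_def eigenvector_def)
  have ev: "(\<Sum>j<n. a i j * v $ j) = e * v $ i" if "i < n" for i
    using arg_cong[OF v(3), of "\<lambda>x. x $ i"] that v(1)
    by (auto simp: scalar_prod_def lessThan_atLeast0)
  obtain l where l: "l < n" "v $ l \<noteq> 0"
    using v(1,2) eq_vecI[of v "0\<^sub>v n"] by fastforce
  \<comment> \<open>The eigenvalue equation is compared at a coordinate of maximal absolute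
    value.\<close>
  have "Max ((\<lambda>i. \<bar>v $ i\<bar>) ` {..<n}) \<in> (\<lambda>i. \<bar>v $ i\<bar>) ` {..<n}"
    using l by (intro Max_in) auto
  then obtain i where i_max: "i < n" "\<bar>v $ i\<bar> = Max ((\<lambda>i. \<bar>v $ i\<bar>) ` {..<n})" by auto
  hence i: "i < n" "\<And>j. j < n \<Longrightarrow> \<bar>v $ j\<bar> \<le> \<bar>v $ i\<bar>"
    by simp_all
  have "e * \<bar>v $ i\<bar> \<le> \<bar>\<Sum>j<n. a i j * v $ j\<bar>" by (simp add: ev i abs_mult mult_right_mono)
  also have "\<dots> \<le> (\<Sum>j<n. a i j * \<bar>v $ i\<bar>)"
    using i a_nonneg by (intro order_trans[OF sum_abs] sum_mono) (auto simp: abs_mult intro!: mult_left_mono)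
  also have "\<dots> = real k * \<bar>v $ i\<bar>" by (simp add: sum_distrib_right[symmetric] row_sum i)
  finally have "e * \<bar>v $ i\<bar> \<le> real k * \<bar>v $ i\<bar>" .
  moreover have "\<bar>v $ i\<bar> > 0" using i(2)[OF l(1)] l(2) by linarith
  ultimately show ?thesis by simp
qed

lemma eigenvalue_degree:
  assumes "n > 0"
  shows "eigenvalue (mat n n (\<lambda>(i, j). a i j)) (real k)"
  unfolding eigenvalue_def eigenvector_def
proof (intro exI conjI)
  show "vec n (\<lambda>_. 1) \<noteq> (0\<^sub>v (dim_row (mat n n (\<lambda>(i, j). a i j))) :: real vec)"
    using assms by (auto simp: vec_eq_iff)
  show "mat n n (\<lambda>(i, j). a i j) *\<^sub>v vec n (\<lambda>_. 1) = real k \<cdot>\<^sub>v vec n (\<lambda>_. 1)"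
    using row_sum by (intro eq_vecI) (auto simp: scalar_prod_def lessThan_atLeast0)
qed simp

end

section \<open>The bound on the number of vertices\<close>

lemma (in regular_matrix) spectral_bound:
  fixes es :: "real list" and p :: "real poly"
  defines "A \<equiv> mat n n (\<lambda>(i, j). a i j)" and "q \<equiv> sqrt (real k - 1)"
  assumes k: "k > 1" and n: "n > 1"
    and es: "char_poly A = (\<Prod>e\<leftarrow>es. [:- e, 1:])" "length es = n" "sorted_wrt (\<ge>) es"
    and p: "cheb_V_nonneg p" and nonpos: "\<And>x. x \<le> es ! 1 / q \<Longrightarrow> poly p x \<le> 0"
  shows "real n * cheb_V_coeffs p 0 \<le> poly p (real k / q)"
proof -
  have q: "q > 0" "q\<^sup>2 = real k - 1" using k by (auto simp: q_def)
  have A: "A \<in> carrier_mat n n" by (simp add: A_def)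
  let ?tr = "\<lambda>p. \<Sum>e\<leftarrow>es. poly p (e / q)"
  have tr: "?tr (cheb_V j) \<ge> 0" for j
  proof -
    have "q ^ j * ?tr (cheb_V j) = (\<Sum>i<n. cheb_mat (real k - 1) A j $$ (i, i))"
      using sum_list_cheb_V_eq_trace[OF A es(1), of q j] q by simp
    also have "\<dots> \<ge> 0"
      unfolding A_def by (intro sum_nonneg) (simp add: cheb_mat_eq_nb_par nb_par_nonneg)
    finally show ?thesis
      using mult_le_cancel_left_pos[of "q ^ j" 0 "?tr (cheb_V j)"] q(1) by simp
  qed
  obtain N where N: "\<And>j. j \<ge> N \<Longrightarrow> cheb_V_coeffs p j = 0"
    "p = (\<Sum>j<N. smult (cheb_V_coeffs p j) (cheb_V j))"
    using cheb_V_expansion[of p] by blast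
  have pos: "cheb_V_coeffs p j * ?tr (cheb_V j) \<ge> 0" for j
    using p tr[of j] by (simp add: cheb_V_nonneg_def)
  \<comment> \<open>The sum for \<open>cheb_V 0 = 1\<close> is the number of eigenvalues; including
    the other indices can only increase the total.\<close>
  have "real n * cheb_V_coeffs p 0 = cheb_V_coeffs p 0 * ?tr (cheb_V 0)"
    by (simp add: cheb_V_0 es(2) sum_list_triv)
  also have "\<dots> \<le> (\<Sum>j<N. cheb_V_coeffs p j * ?tr (cheb_V j))"
  proof (cases "N = 0")
    case True
    then show ?thesis using N(1)[of 0] by simp
  next
    case False
    then show ?thesis
      by (intro member_le_sum[where f = "\<lambda>j. cheb_V_coeffs p j * ?tr (cheb_V j)"]) (use pos in auto)
  qed
  also have "\<dots> = ?tr p"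
  proof -
    have "poly p x = (\<Sum>j<N. cheb_V_coeffs p j * poly (cheb_V j) x)" for x
      by (subst N(2)) (simp add: poly_sum)
    moreover have "(\<Sum>e\<leftarrow>xs. \<Sum>j<N. f j e) = (\<Sum>j<N. \<Sum>e\<leftarrow>xs. f j e)"
      for xs :: "real list" and f :: "nat \<Rightarrow> real \<Rightarrow> real"
      by (induction xs) (simp_all add: sum.distrib)
    ultimately show ?thesis by (simp only: sum_list_const_mult)
  qed
  also have "?tr p \<le> poly p (real k / q)"
  proof -
    obtain e0 e1 r where es_eq: "es = e0 # e1 # r"
      using n es(2) by (cases es; cases "tl es") auto
    have ev: "eigenvalue A e \<longleftrightarrow> e \<in> set es" for e
      unfolding eigenvalue_root_char_poly[OF A] es(1)
      by (auto simp: poly_prod_list prod_list_zero_iff)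
    \<comment> \<open>\<open>k\<close> is an eigenvalue and bounds all others, so it heads the
      descending list.\<close>
    have "real k \<in> set es" using eigenvalue_degree n ev by (simp add: A_def)
    hence "real k \<le> e0" using es(3) by (auto simp: es_eq)
    moreover have "e0 \<le> real k" using eigenvalue_le[of e0] ev[of e0] by (simp add: A_def es_eq)
    ultimately have e0: "e0 = real k" by simp
    \<comment> \<open>Only one copy of \<open>k\<close> is split off. Every later entry is at most
      \<open>es ! 1\<close>, where \<open>p\<close> is nonpositive.\<close>
    have "sum_list (map (\<lambda>e. poly p (e / q)) (e1 # r)) \<le> sum_list (map (\<lambda>e. 0) (e1 # r))"
    proof (intro sum_list_mono nonpos)
      fix e assume "e \<in> set (e1 # r)"
      hence "e \<le> es ! 1" using es(3) by (auto simp: es_eq)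
      thus "e / q \<le> es ! 1 / q" using q(1) by (intro divide_right_mono) auto
    qed
    thus ?thesis by (simp add: es_eq e0)
  qed
  finally show ?thesis .
qed

section \<open>From graphs to matrices\<close>

lemma eigenvalue_list_symmetric:
  assumes "sym (parcs X)"
  shows "char_poly (adjacency_matrix X) = (\<Prod>e\<leftarrow>eigenvalue_list X. [:- e, 1:])"
    and "length (eigenvalue_list X) = card (pverts X)"
    and "sorted_wrt (\<ge>) (eigenvalue_list X)"
proof -
  let ?A = "adjacency_matrix X" and ?n = "card (pverts X)"
  have A: "?A \<in> carrier_mat ?n ?n" by (simp add: adjacency_matrix_def Let_def)
  have "?A $$ (i, j) = ?A $$ (j, i)" if "i < ?n" "j < ?n" for i j
    using that assms by (auto simp: adjacency_matrix_def Let_def sym_def)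
  \<comment> \<open>Since the characteristic polynomial splits over the reals, its real roots with
    multiplicity account for all eigenvalues.\<close>
  from real_symmetric_char_poly_splits[OF A this]
  obtain es where es: "char_poly ?A = (\<Prod>e\<leftarrow>es. [:- e, 1:])" "length es = ?n" by blast
  have nz: "(\<Prod>e\<leftarrow>es. [:- e, 1:]) \<noteq> 0" for es :: "real list"
    by (auto simp: prod_list_zero_iff)
  have "proots (\<Prod>e\<leftarrow>es. [:- e, 1:]) = mset es"
    by (induction es) (simp_all add: proots_mult[OF pCons_one_nonzero nz] del: mult_pCons_left)
  hence mset: "mset (eigenvalue_list X) = mset es"
    by (simp add: eigenvalue_list_def es(1))
  have "(\<Prod>e\<leftarrow>eigenvalue_list X. [:- e, 1:]) = (\<Prod>e\<leftarrow>es. [:- e, 1:])"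
    by (metis mset mset_map prod_mset_prod_list)
  thus "char_poly ?A = (\<Prod>e\<leftarrow>eigenvalue_list X. [:- e, 1:])" using es(1) by simp
  show "length (eigenvalue_list X) = ?n" using mset es(2) by (metis size_mset)
  show "sorted_wrt (\<ge>) (eigenvalue_list X)"
    by (simp add: eigenvalue_list_def sorted_wrt_rev)
qed

lemma regular_graph_bound:
  fixes z :: real and k :: nat
  defines "q \<equiv> sqrt (real k - 1)"
  assumes k: "k \<ge> 3" and X: "regular_graph k X" and z: "mu1 X \<le> z" and ne: "pverts X \<noteq> {}"
    and p: "cheb_V_nonneg p" and nonpos: "\<And>x. x \<le> z / q \<Longrightarrow> poly p x \<le> 0"
  shows "real (card (pverts X)) * cheb_V_coeffs p 0 \<le> poly p (real k / q)"
proof -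
  let ?n = "card (pverts X)" and ?vs = "sorted_list_of_set (pverts X)"
  interpret X: pair_graph X using X by (simp add: regular_graph_def)
  have fin: "finite (pverts X)" by (rule X.pair_finite_verts)
  have sym: "sym (parcs X)"
    using X.pair_sym_arcs by (auto simp: symmetric_def arcs_ends_def arc_to_ends_def)
  define a :: "nat \<Rightarrow> nat \<Rightarrow> real"
    where "a = (\<lambda>i j. if (?vs ! i, ?vs ! j) \<in> parcs X then 1 else 0)"
  have bij: "bij_betw ((!) ?vs) {..<?n} (pverts X)"
    using fin by (intro bij_betw_nth) auto
  interpret regular_matrix ?n k a
  proof
    fix i assume "i < ?n"
    hence u: "?vs ! i \<in> pverts X" using bij by (auto simp: bij_betw_def)
    have "(\<Sum>j<?n. a i j) = (\<Sum>v\<in>pverts X. if (?vs ! i, v) \<in> parcs X then 1 else 0)"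
      unfolding a_def by (rule sum.reindex_bij_betw[OF bij])
    also have "\<dots> = real (card {v \<in> pverts X. (?vs ! i, v) \<in> parcs X})"
      using fin by (simp add: sum.If_cases Int_def)
    also have "card {v \<in> pverts X. (?vs ! i, v) \<in> parcs X} = card (out_arcs (with_proj X) (?vs ! i))"
      by (rule bij_betw_same_card[of "Pair (?vs ! i)"])
        (auto simp: bij_betw_def inj_on_def image_def
          dest: X.arc_snd_in_verts[of "(u, v)" for u v, simplified])
    also have "\<dots> = k" using X u by (simp add: regular_graph_def out_degree_def)
    finally show "(\<Sum>j<?n. a i j) = real k" .
  qed (use sym in \<open>auto simp: a_def sym_def\<close>)
  have "?n > 0" using ne fin by (simp add: card_gt_0_iff)
  \<comment> \<open>A row with entries 0 and 1 sums to \<open>k\<close>, so there are at least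
    \<open>k\<close> vertices and index 1 of the eigenvalue list exists.\<close>
  hence "real k = (\<Sum>j<?n. a 0 j)" by (simp add: row_sum)
  also have "\<dots> \<le> (\<Sum>j<?n. 1)" by (intro sum_mono) (simp add: a_def)
  finally have n: "?n > 1" using k by simp
  have A: "adjacency_matrix X = mat ?n ?n (\<lambda>(i, j). a i j)"
    by (simp add: adjacency_matrix_def Let_def a_def)
  note es = eigenvalue_list_symmetric[OF sym]
  show ?thesis unfolding q_def
  proof (rule spectral_bound[OF _ n es(1)[unfolded A] es(2,3) p])
    fix x assume "x \<le> eigenvalue_list X ! 1 / sqrt (real k - 1)"
    also have "\<dots> \<le> z / q"
      unfolding q_def using z k by (intro divide_right_mono) (auto simp: mu1_def)
    finally show "poly p x \<le> 0" by (rule nonpos)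
  qed (use k in auto)
qed

text \<open>Because \<open>z / sqrt (k - 1) < 2\<close>, this shows that some index qualifies, so
  the least one is well defined.\<close>

lemma alpha_tendsto: "alpha \<longlonglongrightarrow> 2"
proof -
  have "(\<lambda>m. 2 * cos (pi * inverse (real (Suc m)))) \<longlonglongrightarrow> 2 * cos 0"
    by (intro tendsto_mult_left tendsto_cos tendsto_mult_right_zero[OF LIMSEQ_inverse_real_of_nat])
  thus ?thesis by (simp add: alpha_def[abs_def] field_simps)
qed

theorem theorem1p5:
  fixes k m :: nat and z L s :: real and c :: "nat \<Rightarrow> real"
  assumes "k \<ge> 3"
    and "z < 2 * sqrt (real k - 1)"
    and "L = real k / sqrt (real k - 1)"
    and "m = (LEAST i. 0 < i \<and> z / sqrt (real k - 1) < alpha i)"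
    and "0 < s" and "s < alpha m - z / sqrt (real k - 1)"
    and "c = cheb_V_coeffs (pcompose (F_hat m) [:s, 1:])"
  shows "(\<forall>j. c j \<ge> 0) \<and> c 0 > 0 \<and>
    ereal_of_enat (v_max k z) \<le> ereal (poly (F_hat m) (L + s) / c 0)"
proof -
  define q where "q = sqrt (real k - 1)"
  have q: "q > 0" "q\<^sup>2 = real k - 1" using assms(1) by (auto simp: q_def)
  have "z / q < 2" using assms(2) q(1) by (simp add: q_def[symmetric] field_simps)
  hence "\<forall>\<^sub>F i in sequentially. 0 < i \<and> z / q < alpha i"
    by (intro eventually_conj eventually_gt_at_top order_tendstoD(1)[OF alpha_tendsto])
  hence "\<exists>i. 0 < i \<and> z / q < alpha i" by (auto dest: eventually_happens)
  from LeastI_ex[OF this] have m: "m > 0" unfolding assms(4) q_def by simp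
  define p where "p = pcompose (F_hat m) [:s, 1:]"
  have poly_p: "poly p x = poly (F_hat m) (x + s)" for x
    by (simp add: p_def poly_pcompose add.commute)
  have p: "cheb_V_nonneg p" and c0: "c 0 > 0"
    using cheb_V_nonneg_F_hat_shift[OF m assms(5)] cheb_V_coeffs_F_hat_shift_0_pos[OF m assms(5)]
    by (simp_all add: p_def assms(7))
  have c_eq: "c = cheb_V_coeffs p" by (simp add: p_def assms(7))
  define B where "B = poly (F_hat m) (L + s) / c 0"
  \<comment> \<open>Here \<open>k = q\<^sup>2 + 1\<close>, so \<open>L = q + 1 / q\<close>.\<close>
  have "0 \<le> (q - 1)\<^sup>2" by simp
  also have "\<dots> = real k - 2 * q" using q(2) by (simp add: power2_diff)
  finally have "L \<ge> 2" using q(1) by (simp add: assms(3) q_def[symmetric] field_simps)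
  hence "poly p L \<ge> 0" by (rule poly_nonneg_of_cheb_V_nonneg[OF p])
  hence B: "B \<ge> 0" using c0 by (simp add: B_def poly_p)
  have nonpos: "poly p x \<le> 0" if "x \<le> z / sqrt (real k - 1)" for x
    unfolding poly_p using that assms(6) by (intro poly_F_hat_nonpos[OF m]) simp
  have "real (card (pverts X)) \<le> B" if "regular_graph k X" "mu1 X \<le> z" for X
  \<comment> \<open>Without vertices the claim is just \<open>B \<ge> 0\<close>.\<close>
  proof (cases "pverts X = {}")
    case False
    from regular_graph_bound[OF assms(1) that this p nonpos]
    show ?thesis using c0 by (simp add: B_def poly_p c_eq assms(3) field_simps)
  qed (use B in simp)
  \<comment> \<open>The supremum is taken in \<open>enat\<close>, so the real bound is first rounded
    down.\<close>
  hence "v_max k z \<le> enat (nat \<lfloor>B\<rfloor>)"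
    unfolding v_max_def by (intro Sup_least) (auto simp: le_nat_floor)
  hence "ereal_of_enat (v_max k z) \<le> ereal_of_enat (enat (nat \<lfloor>B\<rfloor>))"
    by (simp only: ereal_of_enat_le_iff)
  also have "\<dots> \<le> ereal B" using B by simp
  finally show ?thesis using p c0 by (simp add: B_def c_eq cheb_V_nonneg_def)
qed

end
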